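(* Let $\alpha\in(1,2)$ and let $X_\alpha$ be a rotationally invariant $\alpha$-stable random vector of $\mathbb{R}^d$ with law $\mu_\alpha$ and with Lévy measure $$\nu_\alpha(du)=\mathbf 1_{(0,+\infty)}(r)\mathbf 1_{\mathbb{S}^{d-1}}(x)\frac{c_{\alpha,d}}{r^{1+\alpha}}dr\,\lambda(dx),$$ where $\lambda$ is the uniform measure on $\mathbb{S}^{d-1}$ and $$c_{\alpha,d}=\frac{-\alpha(\alpha-1)\Gamma((\alpha+d)/2)}{4\cos(\alpha\pi/2)\Gamma((\alpha+1)/2)\pi^{(d-1)/2}\Gamma(2-\alpha)}.$$ Then, for all $f\in\mathcal{C}_c^\infty(\mathbb{R}^d)$, $$\Gamma_2(f,f)\ge\frac{\alpha}{2}\,\Gamma(f,f)$$ (pointwise on $\mathbb{R}^d$), where $\Gamma$ and $\Gamma_2$ are respectively the carré du champs operator and the iterated carré du champs operator of order $2$ associated with $\nu_\alpha$.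
   Context: $\mathbb{S}^{d-1}$: Euclidean unit sphere; polar coordinates $u=rx$; $\lambda$ is the (unnormalized) surface measure, so that $\nu_\alpha(du)=c_{\alpha,d}\|u\|^{-d-\alpha}du$; $\Gamma(\cdot)$ with a scalar argument is Euler's Gamma function. $\mathcal{C}_c^\infty(\mathbb{R}^d)$: infinitely differentiable compactly supported functions. Let $\mathcal{A}(f)(x)=-\langle x;\nabla f(x)\rangle+\int_{\mathbb{R}^d}\langle\nabla f(x+u)-\nabla f(x);u\rangle\nu_\alpha(du)$ and $\tilde\nu_\alpha(du)=\alpha\,\nu_\alpha(du)$. The carré du champs operator is $\Gamma(f,g)(x)=\frac12\int_{\mathbb{R}^d}(f(x+u)-f(x))(g(x+u)-g(x))\tilde\nu_\alpha(du)=\frac12(\mathcal{A}(fg)-f\mathcal{A}(g)-g\mathcal{A}(f))(x)$, and the iterated carré du champs of order $2$ is $\Gamma_2(f,g)(x)=\frac12\big(\mathcal{A}(\Gamma(f,g))(x)-\Gamma(\mathcal{A}(f),g)(x)-\Gamma(\mathcal{A}(g),f)(x)\big)$, with $\mathcal{A}$ and $\Gamma$ applied to the smooth functions involved through their integral formulas. *)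

theory Defs
  imports "HOL-Probability.Probability"
begin

section \<open>Test functions\<close>

definition gradient :: "('a::real_inner \<Rightarrow> real) \<Rightarrow> 'a \<Rightarrow> 'a" where
  "gradient f x = (THE D. GDERIV f x :> D)"

fun Ck :: "nat \<Rightarrow> ('a::euclidean_space \<Rightarrow> real) \<Rightarrow> bool" where
  "Ck 0 f \<longleftrightarrow> continuous_on UNIV f"
| "Ck (Suc k) f \<longleftrightarrow>
     (\<forall>x. f differentiable (at x)) \<and> (\<forall>b\<in>Basis. Ck k (\<lambda>x. gradient f x \<bullet> b))"

definition Cc_infinity :: "('a::euclidean_space \<Rightarrow> real) set" where
  "Cc_infinity = {f. (\<forall>k. Ck k f) \<and> compact (closure {x. f x \<noteq> 0})}"

section \<open>The rotationally invariant stable Levy measure\<close>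

text \<open>
  The unnormalized surface measure of the unit sphere \<open>S\<close> of a space of dimension \<open>d\<close> is the cone
  measure: \<open>\<lambda>(B)\<close> is \<open>d\<close> times the Lebesgue measure of \<open>{t x | 0 < t < 1, x \<in> B \<inter> S}\<close>. It is the unique
  measure on \<open>S\<close> for which Lebesgue measure is \<open>r^(d-1) dr \<lambda>(dx)\<close> in polar coordinates, and the counting
  measure on \<open>{-1, 1}\<close> if \<open>d = 1\<close>. It is represented here as a Borel measure on the whole space.
\<close>

definition sphere_measure :: "'a::euclidean_space measure" where
  "sphere_measure =
     scale_measure (of_nat DIM('a)) (distr (restrict_space lborel (ball 0 1 - {0})) borel sgn)"

definition stable_const :: "real \<Rightarrow> nat \<Rightarrow> real" where
  "stable_const \<alpha> d =
     (- \<alpha> * (\<alpha> - 1) * Gamma ((\<alpha> + real d) / 2)) /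
     (4 * cos (\<alpha> * pi / 2) * Gamma ((\<alpha> + 1) / 2) * pi powr ((real d - 1) / 2) * Gamma (2 - \<alpha>))"

text \<open>
  The law of \<open>u = r x\<close> under the polar density. By the polar formula for Lebesgue measure this is
  \<open>stable_const \<alpha> d * norm u powr (- d - \<alpha>) du\<close>.
\<close>

definition stable_levy_measure :: "real \<Rightarrow> 'a::euclidean_space measure" where
  "stable_levy_measure \<alpha> =
     distr
       (density (lborel \<Otimes>\<^sub>M sphere_measure)
          (\<lambda>(r, x). ennreal (indicator {0<..} r * indicator (sphere 0 1) x *
                            (stable_const \<alpha> DIM('a) / r powr (1 + \<alpha>)))))
       borel (\<lambda>(r, x). r *\<^sub>R x)"

section \<open>Stable laws\<close>

definition rotationally_invariant :: "'a::euclidean_space measure \<Rightarrow> bool" where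
  "rotationally_invariant \<mu> \<longleftrightarrow> (\<forall>T. orthogonal_transformation T \<longrightarrow> distr \<mu> borel T = \<mu>)"

text \<open>The sum of \<open>n\<close> independent copies of \<open>X\<close> has the law of \<open>n powr (1 / \<alpha>) X + c\<close>.\<close>

definition stable_law :: "real \<Rightarrow> 'a::euclidean_space measure \<Rightarrow> bool" where
  "stable_law \<alpha> \<mu> \<longleftrightarrow>
     (\<forall>n\<ge>1. \<exists>c. distr (PiM {..<n} (\<lambda>_. \<mu>)) borel (\<lambda>\<omega>. \<Sum>i<n. \<omega> i) =
                distr \<mu> borel (\<lambda>x. real n powr (1 / \<alpha>) *\<^sub>R x + c))"

text \<open>
  Levy--Khintchine representation of the characteristic function, with drift \<open>b\<close> and Gaussian
  covariance \<open>Q\<close> left unspecified.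
\<close>

definition has_levy_measure ::
    "'a::euclidean_space measure \<Rightarrow> 'a measure \<Rightarrow> bool" where
  "has_levy_measure \<mu> \<nu> \<longleftrightarrow>
     sets \<nu> = sets borel \<and> emeasure \<nu> {0} = 0 \<and>
     (\<integral>\<^sup>+u. ennreal (min 1 ((norm u)\<^sup>2)) \<partial>\<nu>) < \<infinity> \<and>
     (\<exists>b Q. linear Q \<and> (\<forall>x y. Q x \<bullet> y = x \<bullet> Q y) \<and> (\<forall>x. 0 \<le> x \<bullet> Q x) \<and>
        (\<forall>\<xi>. (\<integral>x. iexp (\<xi> \<bullet> x) \<partial>\<mu>) =
              exp (\<i> * of_real (\<xi> \<bullet> b) - of_real (\<xi> \<bullet> Q \<xi>) / 2 +
                   (\<integral>u. iexp (\<xi> \<bullet> u) - 1 - \<i> * of_real (\<xi> \<bullet> u * indicator (cball 0 1) u) \<partial>\<nu>))))"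

section \<open>Generator and carre du champs operators\<close>

definition stable_generator ::
    "real \<Rightarrow> ('a::euclidean_space \<Rightarrow> real) \<Rightarrow> 'a \<Rightarrow> real" where
  "stable_generator \<alpha> f x =
     - (x \<bullet> gradient f x) +
     (\<integral>u. (gradient f (x + u) - gradient f x) \<bullet> u \<partial>stable_levy_measure \<alpha>)"

definition carre_du_champs ::
    "real \<Rightarrow> ('a::euclidean_space \<Rightarrow> real) \<Rightarrow> ('a \<Rightarrow> real) \<Rightarrow> 'a \<Rightarrow> real" where
  "carre_du_champs \<alpha> f g x =
     1 / 2 * (\<integral>u. (f (x + u) - f x) * (g (x + u) - g x)
                \<partial>scale_measure (ennreal \<alpha>) (stable_levy_measure \<alpha>))"

definition carre_du_champs2 ::
    "real \<Rightarrow> ('a::euclidean_space \<Rightarrow> real) \<Rightarrow> ('a \<Rightarrow> real) \<Rightarrow> 'a \<Rightarrow> real" where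
  "carre_du_champs2 \<alpha> f g x =
     1 / 2 * (stable_generator \<alpha> (carre_du_champs \<alpha> f g) x
              - carre_du_champs \<alpha> (stable_generator \<alpha> f) g x
              - carre_du_champs \<alpha> (stable_generator \<alpha> g) f x)"

end

theory Submission
  imports Defs
begin

text \<open>
  Put \<open>F\<^sub>v(x) = f(x + v) - f(x)\<close>. An integration by parts in the radial variable turns the jump part of the
  generator into \<open>L g(x) = \<alpha> \<integral> (g(x + u) - g(x) - \<langle>\<nabla>g(x); u\<rangle>) \<nu>(du)\<close>, so that the generator is \<open>L - x \<cdot> \<nabla>\<close>.
  By Fubini, \<open>L\<close> contributes \<open>\<alpha>\<^sup>2 / 4 * \<integral>\<integral> (F\<^sub>v(x + u) - F\<^sub>v(x))\<^sup>2 \<nu>(dv) \<nu>(du) \<ge> 0\<close> to \<open>\<Gamma>\<^sub>2(f, f)(x)\<close>.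
  The drift contributes \<open>\<alpha> / 4 * \<integral> \<langle>v; \<nabla>\<^sub>v (F\<^sub>v(x)\<^sup>2)\<rangle> \<nu>(dv)\<close>, and the same integration by parts identifies
  it with \<open>\<alpha> / 2 * \<Gamma>(f, f)(x)\<close>.
\<close>

section \<open>The stable Levy measure\<close>

text \<open>This is the smaller of \<open>norm u\<close> and its square: quadratic at the origin and
  linear at infinity, like the Taylor remainder of a bounded function with bounded Lipschitz
  gradient. It is the common dominating function below.\<close>

definition levy_weight :: "'a::real_normed_vector \<Rightarrow> real" where
  "levy_weight u = norm u * min 1 (norm u)"

lemma sets_sphere_measure [simp, measurable_cong]:
  "sets (sphere_measure :: 'a::euclidean_space measure) = sets borel"
  by (simp add: sphere_measure_def)

lemma sets_stable_levy_measure [simp, measurable_cong]: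
  "sets (stable_levy_measure \<alpha>) = sets borel"
  by (simp add: stable_levy_measure_def)

lemma finite_sphere_measure:
  "finite_measure (sphere_measure :: 'a::euclidean_space measure)"
proof
  let ?B = "ball (0::'a) 1 - {0}"
  have sgn: "(sgn :: 'a \<Rightarrow> 'a) \<in> restrict_space lborel ?B \<rightarrow>\<^sub>M borel"
    by (rule measurable_restrict_space1) (simp add: sgn_div_norm [abs_def])
  have "emeasure (restrict_space lborel ?B) (sgn -` UNIV \<inter> space (restrict_space lborel ?B)) 
      \<le> emeasure lborel (ball (0::'a) 1)"
    by (subst emeasure_restrict_space) (auto simp: space_restrict_space intro!: emeasure_mono)
  also have "\<dots> < top"
    using emeasure_bounded_finite [of "ball (0::'a) 1"] by simp
  finally have "emeasure (sphere_measure :: 'a measure) UNIV < top"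
    using sgn by (simp add: sphere_measure_def emeasure_distr ennreal_mult_less_top of_nat_less_top)
  then show "emeasure (sphere_measure :: 'a measure) (space sphere_measure) \<noteq> \<infinity>"
    by (simp add: sphere_measure_def space_scale_measure)
qed

text \<open>Tonelli with the radial integral innermost, so that the radius can be substituted in
  each fixed direction.\<close>

lemma nn_integral_stable_levy_measure:
  fixes f :: "'a::euclidean_space \<Rightarrow> ennreal"
  assumes [measurable]: "f \<in> borel_measurable borel"
  shows "(\<integral>\<^sup>+u. f u \<partial>stable_levy_measure \<alpha>) =
    (\<integral>\<^sup>+x. (\<integral>\<^sup>+r. ennreal (indicator {0<..} r * indicator (sphere 0 1) x *
        (stable_const \<alpha> DIM('a) / r powr (1 + \<alpha>))) * f (r *\<^sub>R x) \<partial>lborel) \<partial>sphere_measure)"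
proof -
  interpret S: finite_measure "sphere_measure :: 'a measure"
    by (rule finite_sphere_measure)
  interpret P: pair_sigma_finite lborel "sphere_measure :: 'a measure" ..
  have [measurable]: "sphere (0::'a) 1 \<in> sets borel" by simp
  show ?thesis
    unfolding stable_levy_measure_def
    by (simp add: nn_integral_distr nn_integral_density split_beta' P.nn_integral_snd [symmetric])
qed

text \<open>The polar density vanishes unless \<open>r\<close> is positive and \<open>x\<close> is a
  unit vector, and then \<open>r *\<^sub>R x\<close> is nonzero.\<close>

lemma emeasure_stable_levy_measure_0:
  "emeasure (stable_levy_measure \<alpha>) {0::'a::euclidean_space} = 0"
proof -
  have "emeasure (stable_levy_measure \<alpha>) {0::'a} = (\<integral>\<^sup>+u. indicator {0::'a} u \<partial>stable_levy_measure \<alpha>)"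
    by (rule nn_integral_indicator [symmetric]) simp
  also have "\<dots> = 0"
    by (subst nn_integral_stable_levy_measure)
       (auto intro!: nn_integral_zero' AE_I2 split: split_indicator simp: indicator_def)
  finally show ?thesis .
qed

text \<open>In each direction substitute the radius: homogeneity of the density of degree
  \<open>-(1 + \<alpha>)\<close> yields \<open>t powr (1 + \<alpha>)\<close>, and the Jacobian takes
  back one power of \<open>t\<close>.\<close>

lemma nn_integral_stable_levy_measure_scaleR:
  fixes f :: "'a::euclidean_space \<Rightarrow> ennreal"
  assumes [measurable]: "f \<in> borel_measurable borel" and t: "0 < t"
  shows "(\<integral>\<^sup>+u. f (t *\<^sub>R u) \<partial>stable_levy_measure \<alpha>) =
    ennreal (t powr \<alpha>) * (\<integral>\<^sup>+u. f u \<partial>stable_levy_measure \<alpha>)"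
proof -
  define k :: "real \<Rightarrow> 'a \<Rightarrow> ennreal" where
    "k = (\<lambda>r x. ennreal (indicator {0<..} r * indicator (sphere 0 1) x *
        (stable_const \<alpha> DIM('a) / r powr (1 + \<alpha>))))"
  have [measurable]: "sphere (0::'a) 1 \<in> sets borel" by simp
  have [measurable]: "case_prod k \<in> borel_measurable (borel \<Otimes>\<^sub>M borel)"
    unfolding k_def by measurable
  have k: "k r x = ennreal (t powr (1 + \<alpha>)) * k (t * r) x" for r x
    using t by (auto simp: k_def indicator_def powr_mult zero_less_mult_iff divide_simps
        simp flip: ennreal_mult')
  have k': "ennreal (t powr (1 + \<alpha>)) * (k (t * r) x * z) = k r x * z" for r x z
    using k [of r x] by (simp add: mult.assoc)
  interpret S: finite_measure "sphere_measure :: 'a measure"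
    by (rule finite_sphere_measure)
  have "(\<integral>\<^sup>+r. k r x * f (r *\<^sub>R t *\<^sub>R x) \<partial>lborel)
      = ennreal (t powr \<alpha>) * (\<integral>\<^sup>+r. k r x * f (r *\<^sub>R x) \<partial>lborel)" for x
  proof -
    have "(\<integral>\<^sup>+r. k r x * f (r *\<^sub>R x) \<partial>lborel)
        = ennreal t * (\<integral>\<^sup>+r. k (t * r) x * f (r *\<^sub>R t *\<^sub>R x) \<partial>lborel)"
      using t by (subst nn_integral_real_affine [where c = t and t = 0]) (auto simp: mult.commute)
    then have "ennreal (t powr \<alpha>) * (\<integral>\<^sup>+r. k r x * f (r *\<^sub>R x) \<partial>lborel)
        = ennreal (t powr \<alpha>) * ennreal t * (\<integral>\<^sup>+r. k (t * r) x * f (r *\<^sub>R t *\<^sub>R x) \<partial>lborel)"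
      by (simp add: mult.assoc)
    also have "ennreal (t powr \<alpha>) * ennreal t = ennreal (t powr (1 + \<alpha>))"
      using t by (simp add: powr_add mult.commute flip: ennreal_mult)
    also have "ennreal (t powr (1 + \<alpha>)) * (\<integral>\<^sup>+r. k (t * r) x * f (r *\<^sub>R t *\<^sub>R x) \<partial>lborel)
        = (\<integral>\<^sup>+r. k r x * f (r *\<^sub>R t *\<^sub>R x) \<partial>lborel)"
      by (subst nn_integral_cmult [symmetric]) (simp_all add: k')
    finally show ?thesis by simp
  qed
  note * = this
  have nn: "(\<integral>\<^sup>+u. g u \<partial>stable_levy_measure \<alpha>) =
      (\<integral>\<^sup>+x. (\<integral>\<^sup>+r. k r x * g (r *\<^sub>R x) \<partial>lborel) \<partial>sphere_measure)"
    if "g \<in> borel_measurable borel" for g :: "'a \<Rightarrow> ennreal"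
    unfolding k_def by (rule nn_integral_stable_levy_measure [OF that])
  have "(\<integral>\<^sup>+u. f (t *\<^sub>R u) \<partial>stable_levy_measure \<alpha>) =
      (\<integral>\<^sup>+x. (\<integral>\<^sup>+r. k r x * f (t *\<^sub>R r *\<^sub>R x) \<partial>lborel) \<partial>sphere_measure)"
    by (rule nn) simp
  also have "\<dots> = (\<integral>\<^sup>+x. ennreal (t powr \<alpha>) * (\<integral>\<^sup>+r. k r x * f (r *\<^sub>R x) \<partial>lborel) \<partial>sphere_measure)"
    unfolding * [symmetric] by (simp add: mult.commute)
  also have "\<dots> = ennreal (t powr \<alpha>) * (\<integral>\<^sup>+u. f u \<partial>stable_levy_measure \<alpha>)"
    by (simp add: nn nn_integral_cmult)
  finally show ?thesis .
qed

lemma distr_stable_levy_measure_scaleR: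
  fixes t :: real
  assumes "0 < t"
  shows "distr (stable_levy_measure \<alpha> :: 'a::euclidean_space measure) borel (\<lambda>u. t *\<^sub>R u) =
    scale_measure (ennreal (t powr \<alpha>)) (stable_levy_measure \<alpha>)" (is "?L = ?R")
proof (rule measure_eqI)
  fix A assume "A \<in> sets ?L"
  then have [measurable]: "A \<in> sets borel" by simp
  have "emeasure ?L A = (\<integral>\<^sup>+u. indicator A u \<partial>?L)"
    by simp
  also have "\<dots> = (\<integral>\<^sup>+u. indicator A (t *\<^sub>R u) \<partial>stable_levy_measure \<alpha>)"
    by (subst nn_integral_distr) auto
  also have "\<dots> = emeasure ?R A"
    using assms by (subst nn_integral_stable_levy_measure_scaleR) auto
  finally show "emeasure ?L A = emeasure ?R A" .
qed simp

text \<open>The radial integrand is \<open>r powr (1 - \<alpha>)\<close> near 0, integrable because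
  \<alpha> < 2, and \<open>r powr (- \<alpha>)\<close> at infinity, integrable because \<alpha> > 1.
  The sphere has finite mass.\<close>

lemma integrable_levy_weight:
  assumes \<alpha>: "1 < \<alpha>" "\<alpha> < 2"
  shows "integrable (stable_levy_measure \<alpha> :: 'a::euclidean_space measure) levy_weight"
proof (rule integrableI_nonneg)
  show meas [measurable]: "levy_weight \<in> borel_measurable (stable_levy_measure \<alpha> :: 'a measure)"
    unfolding levy_weight_def [abs_def] by measurable
  show "AE u::'a in stable_levy_measure \<alpha>. 0 \<le> levy_weight u"
    by (simp add: levy_weight_def)
  \<comment> \<open>The absolute value makes the estimate independent of the sign of the
    constant.\<close>
  define c where "c = \<bar>stable_const \<alpha> DIM('a)\<bar>"
  \<comment> \<open>\<open>k\<close> and \<open>l\<close> are the radial integrands inside and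
    outside the unit ball. Both are nonzero at radius 1, so their sum is only an upper bound
    there.\<close>
  define k where "k = (\<lambda>r::real. if r \<in> {0..1} then r powr (1 - \<alpha>) else 0)"
  define l where "l = (\<lambda>r::real. if r \<in> {1..} then r powr (- \<alpha>) else 0)"
  have "(k has_integral (1 / (2 - \<alpha>))) UNIV"
    unfolding k_def has_integral_restrict_UNIV
    using has_integral_powr_from_0 [of "1 - \<alpha>" 1] \<alpha> by simp
  then have k: "(\<integral>\<^sup>+r. k r \<partial>lborel) = ennreal (1 / (2 - \<alpha>))"
    by (intro nn_integral_has_integral_lborel) (auto simp: k_def)
  have "(l has_integral (1 / (\<alpha> - 1))) UNIV"
    unfolding l_def has_integral_restrict_UNIV
    using has_integral_powr_to_inf [of "- \<alpha>" 1] \<alpha> minus_divide_right [of 1 "1 - \<alpha>"] by simp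
  then have l: "(\<integral>\<^sup>+r. l r \<partial>lborel) = ennreal (1 / (\<alpha> - 1))"
    by (intro nn_integral_has_integral_lborel) (auto simp: l_def)
  have [measurable]: "k \<in> borel_measurable borel" "l \<in> borel_measurable borel"
    unfolding k_def l_def by measurable
  have "(\<integral>\<^sup>+u. ennreal (levy_weight u) \<partial>(stable_levy_measure \<alpha> :: 'a measure))
      \<le> (\<integral>\<^sup>+x. (\<integral>\<^sup>+r. ennreal c * (ennreal (k r) + ennreal (l r)) \<partial>lborel) \<partial>(sphere_measure :: 'a measure))"
  proof (subst nn_integral_stable_levy_measure, goal_cases)
    case 1
    show ?case using meas by simp
  next
    case 2
    show ?case
    proof (intro nn_integral_mono)
      fix x :: 'a and r :: real
      have "indicator {0<..} r * indicator (sphere 0 1) x * (stable_const \<alpha> DIM('a) / r powr (1 + \<alpha>)) * levy_weight (r *\<^sub>R x)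
        \<le> c * (k r + l r)"
      proof (cases "0 < r \<and> norm x = 1")
        case True
        have "stable_const \<alpha> DIM('a) / r powr (1 + \<alpha>) * levy_weight (r *\<^sub>R x) \<le> c / r powr (1 + \<alpha>) * levy_weight (r *\<^sub>R x)"
          by (intro mult_right_mono divide_right_mono) (auto simp: c_def levy_weight_def)
        also have "\<dots> = c * (levy_weight (r *\<^sub>R x) / r powr (1 + \<alpha>))"
          by simp
        also have "levy_weight (r *\<^sub>R x) / r powr (1 + \<alpha>) \<le> k r + l r"
          using True by (cases "r \<le> 1")
            (auto simp: k_def l_def levy_weight_def powr_diff powr_add powr_minus divide_simps)
        finally show ?thesis using True by (simp add: c_def mult_left_mono)
      qed (auto simp: c_def k_def l_def indicator_def)
      then show "ennreal (indicator {0<..} r * indicator (sphere 0 1) x *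
          (stable_const \<alpha> DIM('a) / r powr (1 + \<alpha>))) * ennreal (levy_weight (r *\<^sub>R x))
          \<le> ennreal c * (ennreal (k r) + ennreal (l r))"
        by (simp add: levy_weight_def k_def l_def c_def ennreal_leI
            flip: ennreal_mult'' ennreal_plus ennreal_mult)
    qed
  qed
  also have "\<dots> < \<infinity>"
    using finite_measure.emeasure_finite [OF finite_sphere_measure, of "UNIV :: 'a set"]
    by (simp add: nn_integral_cmult nn_integral_add k l sets_eq_imp_space_eq [OF sets_sphere_measure] ennreal_mult_less_top less_top)
  finally show "(\<integral>\<^sup>+u. ennreal (levy_weight u) \<partial>(stable_levy_measure \<alpha> :: 'a measure)) < \<infinity>" .
qed

section \<open>Functions with bounded Lipschitz gradient\<close>

text \<open>All bounds are tied to one constant because it is later integrated over a parameter: for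
  \<open>y \<mapsto> f(y + v) - f(y)\<close> it is \<open>C * min 1 (norm v)\<close>, whose square is integrable in \<open>v\<close>.\<close>

definition tame :: "real \<Rightarrow> ('a::euclidean_space \<Rightarrow> real) \<Rightarrow> ('a \<Rightarrow> 'a) \<Rightarrow> bool" where
  "tame C g g' \<longleftrightarrow> (\<forall>x. GDERIV g x :> g' x) \<and> (\<forall>x. \<bar>g x\<bar> \<le> C) \<and> (\<forall>x. norm (g' x) \<le> C) \<and>
     (\<forall>x y. norm (g' x - g' y) \<le> C * norm (x - y))"

lemma tameD:
  assumes "tame C g g'"
  shows "GDERIV g x :> g' x" "\<bar>g x\<bar> \<le> C" "norm (g' x) \<le> C" "norm (g' x - g' y) \<le> C * norm (x - y)"
  using assms by (auto simp: tame_def)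

lemma tame_nonneg: "tame C g g' \<Longrightarrow> 0 \<le> C"
  using tameD(2)[of C g g' 0] by linarith

lemma tame_mono:
  assumes "tame C g g'" "C \<le> D"
  shows "tame D g g'"
proof -
  have "C * norm (x - y) \<le> D * norm (x - y)" for x y :: 'a
    using assms(2) by (rule mult_right_mono) simp
  then show ?thesis
    using assms unfolding tame_def by (meson order_trans)
qed

section \<open>Gradients, increments and Taylor remainders\<close>

lemma gderiv_lipschitz:
  fixes g :: "'a::real_inner \<Rightarrow> real"
  assumes "\<And>x. GDERIV g x :> g' x" "\<And>x. norm (g' x) \<le> C"
  shows "\<bar>g x - g y\<bar> \<le> C * norm (x - y)"
proof -
  have "norm (g x - g y) \<le> C * norm (x - y)"
  proof (rule differentiable_bound [of UNIV g "\<lambda>x h. h \<bullet> g' x"])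
    fix x
    have "onorm (\<lambda>h. h \<bullet> g' x) \<le> norm (g' x)"
      by (rule onorm_bound) (auto simp: Cauchy_Schwarz_ineq2 mult.commute[of "norm (g' x)"])
    then show "onorm (\<lambda>h. h \<bullet> g' x) \<le> C"
      using assms(2)[of x] by simp
  qed (use assms(1) in \<open>auto simp: gderiv_def\<close>)
  then show ?thesis by simp
qed

lemma gderiv_unique:
  fixes D D' :: "'a::real_inner"
  assumes "GDERIV f x :> D" "GDERIV f x :> D'"
  shows "D = D'"
proof -
  have "(\<lambda>h. h \<bullet> D) = (\<lambda>h. h \<bullet> D')"
    using assms has_derivative_unique unfolding gderiv_def by blast
  then have "(D - D') \<bullet> D = (D - D') \<bullet> D'" by metis
  then have "(D - D') \<bullet> (D - D') = 0" by (simp add: inner_diff_right)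
  then show ?thesis by simp
qed

lemma gradient_eq: "GDERIV f x :> D \<Longrightarrow> gradient f x = D"
  unfolding gradient_def by (rule the_equality) (auto dest: gderiv_unique)

text \<open>Riesz representation in coordinates gives the existence behind the definite description
  in \<open>gradient\<close>.\<close>

lemma gderiv_gradient:
  fixes f :: "'a::euclidean_space \<Rightarrow> real"
  assumes "f differentiable (at x)"
  shows "GDERIV f x :> gradient f x"
proof -
  obtain D where D: "(f has_derivative D) (at x)"
    using assms by (auto simp: differentiable_def)
  then interpret D: bounded_linear D by (rule has_derivative_bounded_linear)
  have "D h = h \<bullet> (\<Sum>b\<in>Basis. D b *\<^sub>R b)" for h
  proof -
    have "D h = D (\<Sum>b\<in>Basis. (h \<bullet> b) *\<^sub>R b)" by (simp add: euclidean_representation)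
    also have "\<dots> = h \<bullet> (\<Sum>b\<in>Basis. D b *\<^sub>R b)"
      by (simp add: D.sum D.scaleR inner_sum_right mult.commute)
    finally show ?thesis .
  qed
  then have "D = (\<lambda>h. h \<bullet> (\<Sum>b\<in>Basis. D b *\<^sub>R b))" by (rule ext)
  then have "GDERIV f x :> (\<Sum>b\<in>Basis. D b *\<^sub>R b)"
    using D unfolding gderiv_def by simp
  then show ?thesis using gradient_eq by metis
qed

text \<open>The bound on \<open>g\<close> serves large \<open>u\<close>, the bound on
  \<open>g'\<close> small \<open>u\<close>; the minimum records both regimes.\<close>

lemma tame_increment:
  assumes "tame C g g'"
  shows "\<bar>g (x + u) - g x\<bar> \<le> 2 * C * min 1 (norm u)"
proof -
  have "\<bar>g (x + u) - g x\<bar> \<le> 2 * C"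
    using tameD(2)[OF assms, of "x + u"] tameD(2)[OF assms, of x] by linarith
  moreover have "\<bar>g (x + u) - g x\<bar> \<le> C * norm (x + u - x)"
    using tameD(1,3)[OF assms] by (rule gderiv_lipschitz)
  moreover have "0 \<le> C * norm u" using tame_nonneg[OF assms] by simp
  ultimately show ?thesis by (auto simp: min_def)
qed

lemma tame_gradient_increment:
  assumes "tame C g g'"
  shows "norm (g' (x + u) - g' x) \<le> 2 * C * min 1 (norm u)"
proof -
  have "norm (g' (x + u) - g' x) \<le> 2 * C"
    using tameD(3)[OF assms, of "x + u"] tameD(3)[OF assms, of x] norm_triangle_ineq4[of "g' (x + u)" "g' x"]
    by linarith
  moreover have "norm (g' (x + u) - g' x) \<le> C * norm (x + u - x)"
    using assms by (rule tameD(4))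
  moreover have "0 \<le> C * norm u" using tame_nonneg[OF assms] by simp
  ultimately show ?thesis by (auto simp: min_def)
qed

text \<open>On the ball of radius \<open>norm u\<close> about \<open>x\<close> the gradient differs
  from \<open>g' x\<close> by at most \<open>2 * C * min 1 (norm u)\<close>. The mean value
  inequality multiplies this by \<open>norm u\<close>, which produces
  \<open>levy_weight\<close>.\<close>

lemma tame_remainder:
  assumes "tame C g g'"
  shows "\<bar>g (x + u) - g x - u \<bullet> g' x\<bar> \<le> 2 * C * levy_weight u"
proof -
  have "norm (g (x + u) - g x - (x + u - x) \<bullet> g' x) \<le> norm (x + u - x) * (2 * C * min 1 (norm u))"
  proof (rule differentiable_bound_linearization [of x "x + u" "cball x (norm u)" g "\<lambda>x h. h \<bullet> g' x" x])
    fix y assume "y \<in> cball x (norm u)"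
    then have "norm (y - x) \<le> norm u" by (simp add: dist_norm norm_minus_commute)
    have "norm (g' y - g' x) \<le> 2 * C * min 1 (norm (y - x))"
      using tame_gradient_increment[OF assms, of x "y - x"] by simp
    also have "\<dots> \<le> 2 * C * min 1 (norm u)"
      using \<open>norm (y - x) \<le> norm u\<close> tame_nonneg[OF assms] by (intro mult_left_mono) auto
    finally have *: "norm (g' y - g' x) \<le> 2 * C * min 1 (norm u)" .
    have "(\<lambda>h. h \<bullet> g' y) - (\<lambda>h. h \<bullet> g' x) = (\<lambda>h. h \<bullet> (g' y - g' x))"
      by (simp add: fun_eq_iff inner_diff_right)
    then have "onorm ((\<lambda>h. h \<bullet> g' y) - (\<lambda>h. h \<bullet> g' x)) = onorm (\<lambda>h. h \<bullet> (g' y - g' x))"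
      by (rule arg_cong)
    also have "\<dots> \<le> norm (g' y - g' x)"
      by (rule onorm_bound) (auto simp: Cauchy_Schwarz_ineq2 mult.commute[of "norm (g' y - g' x)"])
    finally show "onorm ((\<lambda>h. h \<bullet> g' y) - (\<lambda>h. h \<bullet> g' x)) \<le> 2 * C * min 1 (norm u)"
      using * by simp
  next
    fix y
    show "(g has_derivative (\<lambda>h. h \<bullet> g' y)) (at y within cball x (norm u))"
      using tameD(1)[OF assms, of y] by (simp add: gderiv_def has_derivative_at_withinI)
  qed (auto simp: dist_norm mult_left_le_one_le)
  then show ?thesis by (simp add: levy_weight_def mult_ac)
qed

text \<open>Differentiability is read off from an inequality that can be integrated over a
  parameter. This replaces a theorem on differentiation under the integral sign.\<close>

lemma gderiv_of_quadratic_remainder: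
  fixes g :: "'a::real_inner \<Rightarrow> real"
  assumes "\<And>u. \<bar>g (x + u) - g x - u \<bullet> D\<bar> \<le> K * (norm u)\<^sup>2"
  shows "GDERIV g x :> D"
  unfolding gderiv_def has_derivative_at
proof (intro conjI)
  show "bounded_linear (\<lambda>h. h \<bullet> D)" by (rule bounded_linear_inner_left)
  show "(\<lambda>h. norm (g (x + h) - g x - h \<bullet> D) / norm h) \<midarrow>0\<rightarrow> 0"
  proof (rule Lim_null_comparison [where g = "\<lambda>h. K * norm h"])
    show "\<forall>\<^sub>F h in at 0. norm (norm (g (x + h) - g x - h \<bullet> D) / norm h) \<le> K * norm h"
      using assms by (intro always_eventually) (auto simp: divide_simps power2_eq_square mult_ac)
    show "(\<lambda>h. K * norm h) \<midarrow>0\<rightarrow> 0" by (auto intro!: tendsto_eq_intros)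
  qed
qed

text \<open>The factor 4 counts the four products into which the increment of the product gradient
  splits.\<close>

lemma tame_mult:
  assumes f: "tame A f f'" and g: "tame B g g'"
  shows "tame (4 * (A * B)) (\<lambda>x. f x * g x) (\<lambda>x. f x *\<^sub>R g' x + g x *\<^sub>R f' x)"
  unfolding tame_def
proof (intro conjI allI)
  have A: "0 \<le> A" and B: "0 \<le> B" using f g tame_nonneg by auto
  then have AB: "0 \<le> A * B" by simp
  have sc: "norm (a *\<^sub>R z) \<le> r * s" if "\<bar>a\<bar> \<le> r" "norm z \<le> s" for a r s :: real and z :: 'a
    using that by (simp add: mult_mono')
  fix x y
  show "GDERIV (\<lambda>x. f x * g x) x :> (f x *\<^sub>R g' x + g x *\<^sub>R f' x)"
    by (intro GDERIV_mult tameD(1)[OF f] tameD(1)[OF g])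
  have "\<bar>f x * g x\<bar> \<le> A * B"
    unfolding abs_mult using tameD(2)[OF f] tameD(2)[OF g] by (intro mult_mono') auto
  then show "\<bar>f x * g x\<bar> \<le> 4 * (A * B)" using AB by linarith
  have "norm (f x *\<^sub>R g' x + g x *\<^sub>R f' x) \<le> A * B + B * A"
    by (intro norm_triangle_le add_mono sc tameD[OF f] tameD[OF g])
  then show "norm (f x *\<^sub>R g' x + g x *\<^sub>R f' x) \<le> 4 * (A * B)"
    using AB by (simp add: mult.commute[of B A])
  let ?d = "norm (x - y)"
  have eq: "(f x *\<^sub>R g' x + g x *\<^sub>R f' x) - (f y *\<^sub>R g' y + g y *\<^sub>R f' y)
      = (f x *\<^sub>R (g' x - g' y) + (f x - f y) *\<^sub>R g' y) + (g x *\<^sub>R (f' x - f' y) + (g x - g y) *\<^sub>R f' y)"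
    by (simp add: algebra_simps)
  have "norm \<dots> \<le> (A * (B * ?d) + (A * ?d) * B) + (B * (A * ?d) + (B * ?d) * A)"
    by (intro norm_triangle_le add_mono sc tameD[OF f] tameD[OF g]
        gderiv_lipschitz[OF tameD(1,3)[OF f]] gderiv_lipschitz[OF tameD(1,3)[OF g]])
  then show "norm ((f x *\<^sub>R g' x + g x *\<^sub>R f' x) - (f y *\<^sub>R g' y + g y *\<^sub>R f' y)) \<le> 4 * (A * B) * norm (x - y)"
    unfolding eq by (simp add: mult_ac)
qed

lemma gderiv_shift:
  assumes "GDERIV g (x + v) :> D"
  shows "GDERIV (\<lambda>x. g (x + v)) x :> D"
proof -
  have "((\<lambda>x. x + v) has_derivative (\<lambda>h. h)) (at x)"
    by (rule has_derivative_add_const [OF has_derivative_ident])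
  from has_derivative_compose [OF this assms [unfolded gderiv_def]] show ?thesis
    by (simp add: gderiv_def)
qed

text \<open>Each of the three bounds gains a factor \<open>min 1 (norm v)\<close> by passing to a
  difference. For the Lipschitz bound on the gradient this requires control of increments of the
  second derivatives, which the hypothesis on \<open>H\<close> gives componentwise.\<close>

lemma tame_increment_shift:
  fixes f :: "'a::euclidean_space \<Rightarrow> real"
  assumes f: "tame C f f'" and H: "\<And>b. b \<in> Basis \<Longrightarrow> tame C (\<lambda>x. f' x \<bullet> b) (H b)"
  shows "tame (2 * C * DIM('a) * min 1 (norm v)) (\<lambda>x. f (x + v) - f x) (\<lambda>x. f' (x + v) - f' x)"
  unfolding tame_def
proof (intro conjI allI)
  let ?m = "min 1 (norm v)"
  have C: "0 \<le> C" using f tame_nonneg by blast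
  \<comment> \<open>The dimension enters through the comparison with the l1 norm in the Lipschitz
    estimate; \<open>*\<close> loosens the other two bounds to the same constant.\<close>
  have "1 \<le> real DIM('a)" using DIM_ge_Suc0 [where 'a='a] by linarith
  then have *: "2 * C * ?m * 1 \<le> 2 * C * ?m * DIM('a)"
    using C by (intro mult_left_mono) auto
  fix x y
  show "GDERIV (\<lambda>x. f (x + v) - f x) x :> (f' (x + v) - f' x)"
    by (intro GDERIV_diff gderiv_shift tameD(1)[OF f] tameD(1)[OF f])
  show "\<bar>f (x + v) - f x\<bar> \<le> 2 * C * DIM('a) * ?m"
    using tame_increment[OF f, of x v] * by (simp add: mult_ac)
  show "norm (f' (x + v) - f' x) \<le> 2 * C * DIM('a) * ?m"
    using tame_gradient_increment[OF f, of x v] * by (simp add: mult_ac)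
  let ?G = "\<lambda>x. f' (x + v) - f' x"
  have "norm (?G x - ?G y) \<le> (\<Sum>b\<in>Basis. \<bar>(?G x - ?G y) \<bullet> b\<bar>)"
    by (rule norm_le_l1)
  also have "\<dots> \<le> (\<Sum>b\<in>(Basis::'a set). 2 * C * ?m * norm (x - y))"
  proof (rule sum_mono)
    fix b :: 'a assume b: "b \<in> Basis"
    have "\<bar>(\<lambda>x. f' (x + v) \<bullet> b - f' x \<bullet> b) x - (\<lambda>x. f' (x + v) \<bullet> b - f' x \<bullet> b) y\<bar> \<le> 2 * C * ?m * norm (x - y)"
      by (rule gderiv_lipschitz[where g' = "\<lambda>x. H b (x + v) - H b x"])
         (intro GDERIV_diff gderiv_shift tameD(1)[OF H[OF b]] tameD(1)[OF H[OF b]] tame_gradient_increment[OF H[OF b]])+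
    then show "\<bar>(?G x - ?G y) \<bullet> b\<bar> \<le> 2 * C * ?m * norm (x - y)"
      by (simp add: inner_diff_left)
  qed
  also have "\<dots> = 2 * C * DIM('a) * ?m * norm (x - y)"
    by simp
  finally show "norm (?G x - ?G y) \<le> 2 * C * DIM('a) * ?m * norm (x - y)" .
qed

section \<open>Test functions and their increments are tame\<close>

lemma Cc_infinity_gderiv: "f \<in> Cc_infinity \<Longrightarrow> GDERIV f x :> gradient f x"
proof (rule gderiv_gradient)
  assume "f \<in> Cc_infinity"
  then have "Ck (Suc 0) f" unfolding Cc_infinity_def by blast
  then show "f differentiable at x" by simp
qed

text \<open>Closure under partial derivatives lets the sup bound for test functions apply to
  derivatives of any order.\<close>

lemma Cc_infinity_partial:
  assumes f: "f \<in> Cc_infinity" and b: "b \<in> Basis"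
  shows "(\<lambda>x. gradient f x \<bullet> b) \<in> Cc_infinity"
  unfolding Cc_infinity_def mem_Collect_eq
proof (intro conjI allI)
  fix k
  have "Ck (Suc k) f" using f unfolding Cc_infinity_def by blast
  then show "Ck k (\<lambda>x. gradient f x \<bullet> b)" using b by simp
next
  let ?S = "closure {x. f x \<noteq> 0}"
  have "{x. gradient f x \<bullet> b \<noteq> 0} \<subseteq> ?S"
  proof (rule ccontr)
    assume "\<not> {x. gradient f x \<bullet> b \<noteq> 0} \<subseteq> ?S"
    then obtain x where x: "gradient f x \<bullet> b \<noteq> 0" "x \<in> - ?S" by blast
    \<comment> \<open>On the open complement of the support \<open>f\<close> agrees with 0, so its
      gradient vanishes there too.\<close>
    have "((\<lambda>x. 0) has_derivative (\<lambda>h. h \<bullet> 0)) (at x)"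
      by simp
    then have "(f has_derivative (\<lambda>h. h \<bullet> 0)) (at x)"
    proof (rule has_derivative_transform_within_open)
      show "open (- ?S)" by (rule open_Compl) (rule closed_closure)
      show "0 = f y" if "y \<in> - ?S" for y
        using that closure_subset[of "{x. f x \<noteq> 0}"] by auto
    qed (use x in auto)
    then have "gradient f x = 0"
      by (intro gradient_eq) (simp add: gderiv_def)
    then show False using x by simp
  qed
  then have "closure {x. gradient f x \<bullet> b \<noteq> 0} \<subseteq> ?S"
    by (simp add: closure_minimal)
  moreover have "compact ?S" using f unfolding Cc_infinity_def by blast
  ultimately show "compact (closure {x. gradient f x \<bullet> b \<noteq> 0})"
    by (meson bounded_subset closed_closure compact_eq_bounded_closed)
qed

lemma Cc_infinity_bounded:
  assumes f: "f \<in> Cc_infinity"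
  obtains B where "\<And>x. \<bar>f x\<bar> \<le> B"
proof -
  let ?S = "closure {x. f x \<noteq> 0}"
  have "Ck 0 f" using f unfolding Cc_infinity_def by blast
  then have "continuous_on ?S f" using continuous_on_subset by auto
  moreover have "compact ?S" using f unfolding Cc_infinity_def by blast
  ultimately have "bounded (f ` ?S)"
    using compact_continuous_image compact_imp_bounded by blast
  then obtain B where B: "\<And>x. x \<in> ?S \<Longrightarrow> \<bar>f x\<bar> \<le> B"
    unfolding bounded_iff by auto
  have "\<bar>f x\<bar> \<le> max B 0" for x
  proof (cases "f x = 0")
    case False
    then have "x \<in> ?S" using closure_subset by fastforce
    then show ?thesis using B by fastforce
  qed simp
  then show ?thesis by (rule that)
qed

lemma Cc_infinity_gradient_bounded:
  fixes f :: "'a::euclidean_space \<Rightarrow> real"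
  assumes f: "f \<in> Cc_infinity"
  obtains B where "\<And>x. norm (gradient f x) \<le> B"
proof -
  have "\<exists>B. \<forall>x. \<bar>gradient f x \<bullet> b\<bar> \<le> B" if "b \<in> Basis" for b
    using Cc_infinity_bounded[OF Cc_infinity_partial[OF f that]] by metis
  then obtain B where B: "\<And>b x. b \<in> Basis \<Longrightarrow> \<bar>gradient f x \<bullet> b\<bar> \<le> B b" by metis
  have "norm (gradient f x) \<le> (\<Sum>b\<in>Basis. B b)" for x
    by (rule order_trans[OF norm_le_l1]) (intro sum_mono B)
  then show ?thesis by (rule that)
qed

text \<open>Bounded second derivatives make every component of the gradient Lipschitz, and the l1
  norm collects the components.\<close>

lemma Cc_infinity_tame:
  fixes f :: "'a::euclidean_space \<Rightarrow> real"
  assumes f: "f \<in> Cc_infinity"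
  obtains C where "tame C f (gradient f)"
proof -
  obtain A where A: "\<And>x. \<bar>f x\<bar> \<le> A" using Cc_infinity_bounded[OF f] by blast
  obtain B where B: "\<And>x. norm (gradient f x) \<le> B" using Cc_infinity_gradient_bounded[OF f] by blast
  have "\<exists>B. \<forall>x. norm (gradient (\<lambda>x. gradient f x \<bullet> b) x) \<le> B" if "b \<in> Basis" for b
    using Cc_infinity_gradient_bounded[OF Cc_infinity_partial[OF f that]] by metis
  then obtain D where D: "\<And>b x. b \<in> Basis \<Longrightarrow> norm (gradient (\<lambda>x. gradient f x \<bullet> b) x) \<le> D b" by metis
  define L where "L = (\<Sum>b\<in>Basis. D b)"
  have L: "norm (gradient f x - gradient f y) \<le> L * norm (x - y)" for x y
  proof -
    have "norm (gradient f x - gradient f y) \<le> (\<Sum>b\<in>Basis. \<bar>(gradient f x - gradient f y) \<bullet> b\<bar>)"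
      by (rule norm_le_l1)
    also have "\<dots> \<le> (\<Sum>b\<in>Basis. D b * norm (x - y))"
    proof (rule sum_mono)
      fix b :: 'a assume b: "b \<in> Basis"
      show "\<bar>(gradient f x - gradient f y) \<bullet> b\<bar> \<le> D b * norm (x - y)"
        unfolding inner_diff_left
        by (rule gderiv_lipschitz[where g = "\<lambda>x. gradient f x \<bullet> b",
              OF Cc_infinity_gderiv[OF Cc_infinity_partial[OF f b]] D[OF b]])
    qed
    finally show ?thesis by (simp add: L_def sum_distrib_right)
  qed
  let ?C = "max A (max B L)"
  have "L * norm (x - y) \<le> ?C * norm (x - y)" for x y :: 'a
    by (rule mult_right_mono) auto
  then have "tame ?C f (gradient f)"
    unfolding tame_def using A B L Cc_infinity_gderiv[OF f]
    by (meson max.cobounded1 max.cobounded2 order_trans)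
  then show ?thesis by (rule that)
qed

text \<open>Tameness of \<open>f\<close> and of its first partial derivatives supplies the
  regularity that \<open>tame_increment_shift\<close> asks for, with \<open>C\<close> independent of
  \<open>v\<close>.\<close>

lemma Cc_infinity_increment_tame:
  fixes f :: "'a::euclidean_space \<Rightarrow> real"
  assumes f: "f \<in> Cc_infinity"
  obtains C where "0 \<le> C" "\<And>v. tame (C * min 1 (norm v)) (\<lambda>x. f (x + v) - f x) (\<lambda>x. gradient f (x + v) - gradient f x)"
proof -
  obtain A where A: "tame A f (gradient f)" using Cc_infinity_tame[OF f] by blast
  have "\<exists>B. tame B (\<lambda>x. gradient f x \<bullet> b) (gradient (\<lambda>x. gradient f x \<bullet> b))" if "b \<in> Basis" for b
    using Cc_infinity_tame[OF Cc_infinity_partial[OF f that]] by metis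
  then obtain B where B: "\<And>b. b \<in> Basis \<Longrightarrow> tame (B b) (\<lambda>x. gradient f x \<bullet> b) (gradient (\<lambda>x. gradient f x \<bullet> b))"
    by metis
  define C where "C = A + (\<Sum>b\<in>Basis. B b)"
  have B0: "0 \<le> B b" if "b \<in> Basis" for b using B[OF that] tame_nonneg by blast
  have A0: "0 \<le> A" using A tame_nonneg by blast
  have "A \<le> C" using B0 by (simp add: C_def sum_nonneg)
  have "B b \<le> C" if "b \<in> Basis" for b
    using member_le_sum[of b Basis B] that B0 A0 by (fastforce simp: C_def)
  then have "tame (2 * C * DIM('a) * min 1 (norm v)) (\<lambda>x. f (x + v) - f x) (\<lambda>x. gradient f (x + v) - gradient f x)" for v
    using A B \<open>A \<le> C\<close>
    by (intro tame_increment_shift[where H = "\<lambda>b. gradient (\<lambda>x. gradient f x \<bullet> b)"]) (auto intro: tame_mono)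
  moreover have "0 \<le> 2 * C * DIM('a)" using \<open>A \<le> C\<close> A0 by simp
  ultimately show ?thesis by (rule that[rotated])
qed

section \<open>Integrals of tame families over a parameter\<close>

lemma scale_measure_eq_density: "scale_measure r M = density M (\<lambda>_. r)"
  by (rule measure_eqI) (auto simp: emeasure_density nn_integral_cmult_indicator)

text \<open>Only the dominating function has to be integrable: if \<open>k\<close> is not, its
  integral is 0 by default and the bound persists.\<close>

lemma norm_integral_le:
  fixes k :: "'b \<Rightarrow> 'c::{banach, second_countable_topology}"
  assumes "integrable M l" "\<And>v. norm (k v) \<le> l v"
  shows "norm (\<integral>v. k v \<partial>M) \<le> (\<integral>v. l v \<partial>M)"
proof -
  have "norm (\<integral>v. k v \<partial>M) \<le> (\<integral>v. norm (k v) \<partial>M)"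
    by (rule Bochner_Integration.integral_norm_bound)
  also have "\<dots> \<le> (\<integral>v. l v \<partial>M)"
    by (rule integral_mono') (use assms in \<open>auto intro: order_trans[OF norm_ge_zero]\<close>)
  finally show ?thesis .
qed

lemma levy_weight_nonneg [simp]: "0 \<le> levy_weight u"
  by (simp add: levy_weight_def)

lemma levy_weight_measurable [measurable]: "levy_weight \<in> borel_measurable borel"
  unfolding levy_weight_def [abs_def] by measurable

lemma levy_weight_le_square: "levy_weight u \<le> (norm u)\<^sup>2"
  by (simp add: levy_weight_def power2_eq_square mult_left_mono)

lemma truncation_square_le_levy_weight: "min 1 (norm u) * min 1 (norm u) \<le> levy_weight u"
  by (simp add: levy_weight_def mult_right_mono)

lemma tame_borel_measurable:
  assumes "tame C g g'"
  shows "g \<in> borel_measurable borel" "g' \<in> borel_measurable borel"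
proof -
  have "isCont g x" for x
    using tameD(1)[OF assms, of x] has_derivative_continuous unfolding gderiv_def by blast
  then show "g \<in> borel_measurable borel"
    by (intro borel_measurable_continuous_onI continuous_at_imp_continuous_on) auto
  have "C-lipschitz_on UNIV g'"
    using tameD(4)[OF assms] tame_nonneg[OF assms] by (intro lipschitz_onI) (auto simp: dist_norm)
  then show "g' \<in> borel_measurable borel"
    by (intro borel_measurable_continuous_onI lipschitz_on_continuous_on)
qed

lemma tame_cmult:
  assumes "tame C g g'"
  shows "tame (\<bar>c\<bar> * C) (\<lambda>x. c * g x) (\<lambda>x. c *\<^sub>R g' x)"
  unfolding tame_def
proof (intro conjI allI)
  fix x y
  show "GDERIV (\<lambda>x. c * g x) x :> c *\<^sub>R g' x"
    using GDERIV_mult[OF GDERIV_const[of c] tameD(1)[OF assms]] by simp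
  show "\<bar>c * g x\<bar> \<le> \<bar>c\<bar> * C" "norm (c *\<^sub>R g' x) \<le> \<bar>c\<bar> * C"
    using tameD(2,3)[OF assms] by (auto simp: abs_mult mult_left_mono)
  have "norm (c *\<^sub>R (g' x - g' y)) \<le> \<bar>c\<bar> * (C * norm (x - y))"
    using tameD(4)[OF assms] by (simp add: mult_left_mono)
  then show "norm (c *\<^sub>R g' x - c *\<^sub>R g' y) \<le> \<bar>c\<bar> * C * norm (x - y)"
    by (simp add: scaleR_diff_right mult.assoc)
qed

text \<open>Here the base point is fixed and the jump \<open>v\<close> varies, in contrast to
  \<open>tame_increment_shift\<close>. This is the form that the radial identity in \<open>v\<close>
  needs.\<close>

lemma tame_increment_from_point:
  assumes "tame C f f'"
  shows "tame (2 * C) (\<lambda>v. f (x + v) - f x) (\<lambda>v. f' (x + v))"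
  unfolding tame_def
proof (intro conjI allI)
  have C: "0 \<le> C" using assms by (rule tame_nonneg)
  fix u v
  have "GDERIV (\<lambda>v. f (v + x)) v :> f' (x + v)"
    using tameD(1)[OF assms, of "v + x"] by (intro gderiv_shift) (simp add: add.commute)
  from GDERIV_diff[OF this GDERIV_const[of "f x"]]
  show "GDERIV (\<lambda>v. f (x + v) - f x) v :> f' (x + v)"
    by (simp add: add.commute)
  show "\<bar>f (x + v) - f x\<bar> \<le> 2 * C"
    using tameD(2)[OF assms, of "x + v"] tameD(2)[OF assms, of x] by linarith
  show "norm (f' (x + v)) \<le> 2 * C"
    using tameD(3)[OF assms, of "x + v"] C by linarith
  have "norm (f' (x + u) - f' (x + v)) \<le> C * norm (u - v)"
    using tameD(4)[OF assms, of "x + u" "x + v"] by simp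
  moreover have "0 \<le> C * norm (u - v)" using C by simp
  ultimately show "norm (f' (x + u) - f' (x + v)) \<le> 2 * C * norm (u - v)"
    by linarith
qed

text \<open>All bounds in \<open>tame\<close> are linear in the constant, so they integrate term by
  term; the integrated Taylor bound is quadratic and therefore yields the gradient of the
  integral.\<close>

lemma tame_integral:
  fixes g :: "'b \<Rightarrow> 'a::euclidean_space \<Rightarrow> real"
  assumes K: "integrable M K"
    and g: "\<And>v. tame (K v) (g v) (g' v)"
    and meas: "\<And>x. (\<lambda>v. g v x) \<in> borel_measurable M" "\<And>x. (\<lambda>v. g' v x) \<in> borel_measurable M"
  shows "tame (integral\<^sup>L M K) (\<lambda>x. \<integral>v. g v x \<partial>M) (\<lambda>x. \<integral>v. g' v x \<partial>M)"
    and "\<And>x. integrable M (\<lambda>v. g v x)" and "\<And>x. integrable M (\<lambda>v. g' v x)"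
proof -
  have K0: "0 \<le> K v" for v using g tame_nonneg by blast
  show i: "integrable M (\<lambda>v. g v x)" for x
    by (rule Bochner_Integration.integrable_bound[OF K meas(1)]) (use tameD(2)[OF g] K0 in auto)
  show i': "integrable M (\<lambda>v. g' v x)" for x
    by (rule Bochner_Integration.integrable_bound[OF K meas(2)]) (use tameD(3)[OF g] K0 in auto)
  show "tame (integral\<^sup>L M K) (\<lambda>x. \<integral>v. g v x \<partial>M) (\<lambda>x. \<integral>v. g' v x \<partial>M)"
    unfolding tame_def
  proof (intro conjI allI)
    fix x y
    show "GDERIV (\<lambda>x. \<integral>v. g v x \<partial>M) x :> (\<integral>v. g' v x \<partial>M)"
    proof (rule gderiv_of_quadratic_remainder)
      fix u
      have "(\<integral>v. g v (x + u) \<partial>M) - (\<integral>v. g v x \<partial>M) - u \<bullet> (\<integral>v. g' v x \<partial>M)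
          = (\<integral>v. g v (x + u) - g v x - u \<bullet> g' v x \<partial>M)"
        using i i' by simp
      also have "\<bar>\<dots>\<bar> \<le> (\<integral>v. 2 * K v * levy_weight u \<partial>M)"
        unfolding real_norm_def [symmetric]
        by (rule norm_integral_le) (use K tame_remainder[OF g] in auto)
      also have "\<dots> = 2 * integral\<^sup>L M K * levy_weight u"
        by simp
      also have "\<dots> \<le> 2 * integral\<^sup>L M K * (norm u)\<^sup>2"
        using K0 by (intro mult_left_mono levy_weight_le_square) (auto intro!: integral_nonneg_AE)
      finally show "\<bar>(\<integral>v. g v (x + u) \<partial>M) - (\<integral>v. g v x \<partial>M) - u \<bullet> (\<integral>v. g' v x \<partial>M)\<bar>
          \<le> 2 * integral\<^sup>L M K * (norm u)\<^sup>2" .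
    qed
    show "\<bar>\<integral>v. g v x \<partial>M\<bar> \<le> integral\<^sup>L M K"
      using norm_integral_le[OF K, of "\<lambda>v. g v x"] tameD(2)[OF g] by simp
    show "norm (\<integral>v. g' v x \<partial>M) \<le> integral\<^sup>L M K"
      by (rule norm_integral_le[OF K tameD(3)[OF g]])
    have "(\<integral>v. g' v x \<partial>M) - (\<integral>v. g' v y \<partial>M) = (\<integral>v. g' v x - g' v y \<partial>M)"
      using i' by simp
    also have "norm \<dots> \<le> (\<integral>v. K v * norm (x - y) \<partial>M)"
      by (rule norm_integral_le) (use K tameD(4)[OF g] in auto)
    finally show "norm ((\<integral>v. g' v x \<partial>M) - (\<integral>v. g' v y \<partial>M)) \<le> integral\<^sup>L M K * norm (x - y)"
      by simp
  qed
qed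

section \<open>Levy measures homogeneous under dilations\<close>

text \<open>\<open>scaling\<close> says that \<nu>(A / t) is \<open>t powr \<alpha>\<close> times
  \<nu>(A). This and the integrability of the weight are what the argument takes from the polar
  density.\<close>

locale homogeneous_levy_measure =
  fixes \<alpha> :: real and \<nu> :: "'a::euclidean_space measure"
  assumes alpha: "1 < \<alpha>"
    and sets_nu [simp, measurable_cong]: "sets \<nu> = sets borel"
    and null_0: "emeasure \<nu> {0} = 0"
    and integrable_weight: "integrable \<nu> levy_weight"
    and scaling: "\<And>t. 0 < t \<Longrightarrow> distr \<nu> borel (\<lambda>u. t *\<^sub>R u) = scale_measure (ennreal (t powr \<alpha>)) \<nu>"
begin

lemma space_nu [simp]: "space \<nu> = UNIV"
  using sets_eq_imp_space_eq[OF sets_nu] by simp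

text \<open>By Markov's inequality the sets on which the weight is at least \<open>1 / Suc n\<close>
  have finite mass; they cover everything except the origin, a null set.\<close>

sublocale sigma_finite_measure \<nu>
proof
  define A where "A n = {u\<in>space \<nu>. 1 / real (Suc n) \<le> levy_weight u}" for n
  have fin: "emeasure \<nu> (A n) \<noteq> \<infinity>" for n
  proof -
    have "emeasure \<nu> (A n) \<le> ennreal (1 / (1 / real (Suc n)) * (\<integral>u. levy_weight u \<partial>\<nu>))"
      unfolding A_def by (rule integral_Markov_inequality[OF integrable_weight]) auto
    also have "\<dots> < \<infinity>" by simp
    finally show ?thesis by simp
  qed
  show "\<exists>A. countable A \<and> A \<subseteq> sets \<nu> \<and> \<Union>A = space \<nu> \<and> (\<forall>a\<in>A. emeasure \<nu> a \<noteq> \<infinity>)"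
  proof (intro exI[of _ "insert {0} (range A)"] conjI)
    show "insert {0} (range A) \<subseteq> sets \<nu>"
      unfolding A_def by (intro insert_subsetI image_subsetI) measurable
    have "u \<in> \<Union>(insert {0} (range A))" for u
    proof (cases "u = 0")
      case False
      then have "0 < levy_weight u" by (simp add: levy_weight_def)
      then obtain n where "1 / real (Suc n) < levy_weight u"
        using nat_approx_posE by blast
      then show ?thesis by (auto simp: A_def intro: less_imp_le)
    qed simp
    then show "\<Union>(insert {0} (range A)) = space \<nu>" by auto
  qed (use fin null_0 in auto)
qed

lemma integrable_of_weight_bound:
  fixes f :: "'a \<Rightarrow> 'b::{banach, second_countable_topology}"
  assumes "f \<in> borel_measurable borel" "\<And>u. norm (f u) \<le> K * levy_weight u"
  shows "integrable \<nu> f"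
proof (rule Bochner_Integration.integrable_bound[of \<nu> "\<lambda>u. K * levy_weight u"])
  show "AE u in \<nu>. norm (f u) \<le> norm (K * levy_weight u)"
  proof (rule AE_I2)
    fix u
    show "norm (f u) \<le> norm (K * levy_weight u)"
      using assms(2)[of u] unfolding real_norm_def by linarith
  qed
qed (use assms integrable_weight in auto)

lemma integral_scaleR:
  fixes g :: "'a \<Rightarrow> real"
  assumes [measurable]: "g \<in> borel_measurable borel" and t: "0 < t"
  shows "(\<integral>u. g (t *\<^sub>R u) \<partial>\<nu>) = t powr \<alpha> * (\<integral>u. g u \<partial>\<nu>)"
proof -
  have "(\<integral>u. g (t *\<^sub>R u) \<partial>\<nu>) = (\<integral>u. g u \<partial>distr \<nu> borel (\<lambda>u. t *\<^sub>R u))"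
    by (subst integral_distr) auto
  also have "\<dots> = t powr \<alpha> * (\<integral>u. g u \<partial>\<nu>)"
    unfolding scaling[OF t] scale_measure_eq_density by (subst integral_density) auto
  finally show ?thesis .
qed

lemma integrable_scaleR:
  fixes g :: "'a \<Rightarrow> real"
  assumes g: "integrable \<nu> g" and t: "0 < t"
  shows "integrable \<nu> (\<lambda>u. g (t *\<^sub>R u))"
proof -
  have [measurable]: "g \<in> borel_measurable borel"
    using borel_measurable_integrable[OF g] by simp
  have "integrable (distr \<nu> borel (\<lambda>u. t *\<^sub>R u)) g"
    unfolding scaling[OF t] scale_measure_eq_density using g by (subst integrable_density) auto
  then show ?thesis by (subst (asm) integrable_distr_eq) auto
qed

text \<open>Differentiating the scaling identity \<open>\<integral> g (t u) \<nu>(du) = t powr \<alpha> * \<integral> g \<nu>(du)\<close> at \<open>t = 1\<close>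
  replaces an integration by parts in the radial variable. The error term is again controlled by
  scaling: it is of order \<open>s powr \<alpha>\<close>, which is \<open>o(s)\<close> because \<open>\<alpha> > 1\<close>.\<close>

lemma integral_radial_derivative:
  fixes g :: "'a \<Rightarrow> real"
  assumes g: "integrable \<nu> g" and g': "integrable \<nu> (\<lambda>u. u \<bullet> g' u)"
    and rem: "\<And>u z. \<bar>g (u + z) - g u - z \<bullet> g' u\<bar> \<le> K * levy_weight z"
  shows "(\<integral>u. u \<bullet> g' u \<partial>\<nu>) = \<alpha> * (\<integral>u. g u \<partial>\<nu>)"
proof -
  define I J W where "I = (\<integral>u. g u \<partial>\<nu>)" and "J = (\<integral>u. u \<bullet> g' u \<partial>\<nu>)" and "W = (\<integral>u. levy_weight u \<partial>\<nu>)"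
  have [measurable]: "g \<in> borel_measurable borel"
    using borel_measurable_integrable[OF g] by simp
  have bound: "\<bar>((1 + s) powr \<alpha> - 1) / s * I - J\<bar> \<le> K * W * s powr (\<alpha> - 1)" if s: "0 < s" for s
  proof -
    have gi: "integrable \<nu> (\<lambda>u. g ((1 + s) *\<^sub>R u))" using g s by (intro integrable_scaleR) auto
    have wi: "integrable \<nu> (\<lambda>u. levy_weight (s *\<^sub>R u :: 'a))"
      using integrable_scaleR[OF integrable_weight s] .
    \<comment> \<open>Scaling with factor \<open>1 + s\<close> evaluates the first term. The
      remainder is then estimated by \<open>rem\<close> at \<open>z = s *\<^sub>R u\<close>.\<close>
    have "(1 + s) powr \<alpha> * I - I - s * J = (\<integral>u. g ((1 + s) *\<^sub>R u) - g u - s * (u \<bullet> g' u) \<partial>\<nu>)"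
      using g g' gi s by (simp add: I_def J_def integral_scaleR)
    also have "\<bar>\<dots>\<bar> \<le> (\<integral>u. K * levy_weight (s *\<^sub>R u) \<partial>\<nu>)"
      unfolding real_norm_def [symmetric]
    proof (rule norm_integral_le)
      fix u
      show "norm (g ((1 + s) *\<^sub>R u) - g u - s * (u \<bullet> g' u)) \<le> K * levy_weight (s *\<^sub>R u)"
        using rem[of u "s *\<^sub>R u"] by (simp add: scaleR_add_left)
    qed (use wi in auto)
    also have "\<dots> = K * W * s powr \<alpha>"
      using integral_scaleR[of levy_weight s] s by (simp add: W_def)
    finally have *: "\<bar>(1 + s) powr \<alpha> * I - I - s * J\<bar> \<le> K * W * s powr \<alpha>" .
    have "((1 + s) powr \<alpha> - 1) / s * I - J = ((1 + s) powr \<alpha> * I - I - s * J) / s"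
      using s by (simp add: field_simps)
    also have "\<bar>\<dots>\<bar> \<le> K * W * s powr \<alpha> / s"
      using * s by (simp add: divide_right_mono)
    also have "\<dots> = K * W * s powr (\<alpha> - 1)"
      using s by (simp add: powr_diff)
    finally show ?thesis .
  qed
  have "((\<lambda>x. x powr \<alpha>) has_real_derivative \<alpha> * 1 powr (\<alpha> - 1)) (at 1)"
    by (rule has_real_derivative_powr) simp
  then have "((\<lambda>s. ((1 + s) powr \<alpha> - 1) / s) \<longlongrightarrow> \<alpha>) (at 0)"
    by (simp add: DERIV_def)
  then have "((\<lambda>s. ((1 + s) powr \<alpha> - 1) / s) \<longlongrightarrow> \<alpha>) (at_right 0)"
    by (rule filterlim_mono) (auto intro: at_le)
  then have l: "((\<lambda>s. \<bar>((1 + s) powr \<alpha> - 1) / s * I - J\<bar>) \<longlongrightarrow> \<bar>\<alpha> * I - J\<bar>) (at_right 0)"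
    by (intro tendsto_intros)
  have "((\<lambda>s::real. s powr (\<alpha> - 1)) \<longlongrightarrow> 0 powr (\<alpha> - 1)) (at_right 0)"
    using alpha by (intro tendsto_powr2) (auto simp: eventually_at_right_less intro: eventually_mono[OF eventually_at_right_less])
  then have r: "((\<lambda>s. K * W * s powr (\<alpha> - 1)) \<longlongrightarrow> K * W * 0) (at_right 0)"
    by (intro tendsto_mult_left) simp
  \<comment> \<open>As \<open>s\<close> tends to 0 from the right the difference quotient tends to
    the derivative of \<open>x powr \<alpha>\<close> at 1, namely \<alpha>, while the error
    vanishes.\<close>
  have "\<bar>\<alpha> * I - J\<bar> \<le> K * W * 0"
    using bound by (intro tendsto_le[OF _ r l]) (auto simp: eventually_at_right_less intro: eventually_mono[OF eventually_at_right_less])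
  then show ?thesis by (simp add: I_def J_def)
qed

section \<open>The compensated form of the jump operator and the quadratic estimate\<close>

lemma tame_remainder_integrable:
  assumes "tame C g g'"
  shows "integrable \<nu> (\<lambda>u. g (x + u) - g x - u \<bullet> g' x)"
proof -
  have [measurable]: "g \<in> borel_measurable borel" using assms by (rule tame_borel_measurable)
  show ?thesis
    using tame_remainder[OF assms] by (intro integrable_of_weight_bound[where K = "2 * C"]) auto
qed

text \<open>The radial identity is applied to the Taylor remainder of \<open>g\<close> at
  \<open>x\<close> as a function of \<open>u\<close>. Its gradient is
  \<open>g' (x + u) - g' x\<close>, and the affine part cancels in its own remainder, which is that
  of \<open>g\<close> at \<open>x + u\<close>.\<close>

lemma integral_gradient_increment:
  assumes "tame C g g'"
  shows "(\<integral>u. (g' (x + u) - g' x) \<bullet> u \<partial>\<nu>) = \<alpha> * (\<integral>u. g (x + u) - g x - u \<bullet> g' x \<partial>\<nu>)"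
proof -
  have [measurable]: "g \<in> borel_measurable borel" "g' \<in> borel_measurable borel"
    using assms by (auto intro: tame_borel_measurable)
  have "(\<integral>u. u \<bullet> (g' (x + u) - g' x) \<partial>\<nu>) = \<alpha> * (\<integral>u. g (x + u) - g x - u \<bullet> g' x \<partial>\<nu>)"
  proof (rule integral_radial_derivative[where K = "2 * C"])
    show "integrable \<nu> (\<lambda>u. u \<bullet> (g' (x + u) - g' x))"
    proof (rule integrable_of_weight_bound[where K = "2 * C"])
      fix u
      have "norm (u \<bullet> (g' (x + u) - g' x)) \<le> norm u * norm (g' (x + u) - g' x)"
        using Cauchy_Schwarz_ineq2 by simp
      also have "\<dots> \<le> norm u * (2 * C * min 1 (norm u))"
        by (intro mult_left_mono tame_gradient_increment[OF assms]) auto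
      finally show "norm (u \<bullet> (g' (x + u) - g' x)) \<le> 2 * C * levy_weight u"
        by (simp add: levy_weight_def mult_ac)
    qed auto
    show "\<bar>(g (x + (u + z)) - g x - (u + z) \<bullet> g' x) - (g (x + u) - g x - u \<bullet> g' x) - z \<bullet> (g' (x + u) - g' x)\<bar>
        \<le> 2 * C * levy_weight z" for u z
      using tame_remainder[OF assms, of "x + u" z]
      by (simp add: inner_add_left inner_diff_right add.assoc)
  qed (rule tame_remainder_integrable[OF assms])
  then show ?thesis by (simp add: inner_commute)
qed

lemma integrable_weight_product:
  "integrable (\<nu> \<Otimes>\<^sub>M \<nu>) (\<lambda>(u, v). levy_weight u * levy_weight v :: real)"
proof -
  interpret P: pair_sigma_finite \<nu> \<nu> ..
  show ?thesis
    by (rule P.Fubini_integrable) (use integrable_weight in \<open>auto simp: abs_mult\<close>)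
qed

text \<open>This is twice the desired inequality: \<open>h\<close> plays the role of \<Gamma>(f, f),
  \<open>Af\<close> that of the generator, and \<alpha> times the last integral is twice
  \<Gamma>(Af, f). The bound \<open>incr\<close> shrinks with \<open>v\<close>, which makes the
  squared increments integrable.\<close>

lemma curvature_dimension_inequality:
  fixes f :: "'a \<Rightarrow> real"
  assumes f: "tame A f f'"
    and incr: "\<And>v. tame (C * min 1 (norm v)) (\<lambda>y. f (y + v) - f y) (\<lambda>y. f' (y + v) - f' y)"
    and C: "0 \<le> C"
  defines "h \<equiv> \<lambda>x. \<alpha> / 2 * (\<integral>v. (f (x + v) - f x) * (f (x + v) - f x) \<partial>\<nu>)"
    and "Af \<equiv> \<lambda>x. - (x \<bullet> f' x) + (\<integral>u. (f' (x + u) - f' x) \<bullet> u \<partial>\<nu>)"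
  shows "\<alpha> * h x \<le> - (x \<bullet> gradient h x) + (\<integral>u. (gradient h (x + u) - gradient h x) \<bullet> u \<partial>\<nu>)
           - \<alpha> * (\<integral>v. (Af (x + v) - Af x) * (f (x + v) - f x) \<partial>\<nu>)"
proof -
  interpret P: pair_sigma_finite \<nu> \<nu> ..
  have [measurable]: "f \<in> borel_measurable borel" "f' \<in> borel_measurable borel"
    using f by (auto intro: tame_borel_measurable)
  define m where "m v = min 1 (norm v)" for v :: 'a
  define F where "F v y = f (y + v) - f y" for v y
  define G where "G v y = f' (y + v) - f' y" for v y
  \<comment> \<open>\<open>R\<close> and \<open>S\<close> are the Taylor remainders at
    \<open>x\<close>, with step \<open>u\<close>, of \<open>F v\<close> and of its square;
    \<open>G v\<close> is the gradient of \<open>F v\<close>.\<close>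
  define R where "R u v = F v (x + u) - F v x - u \<bullet> G v x" for u v
  define S where "S u v = F v (x + u) * F v (x + u) - F v x * F v x - u \<bullet> (F v x *\<^sub>R G v x + F v x *\<^sub>R G v x)" for u v
  have tF: "tame (C * m v) (F v) (G v)" for v
    using incr[of v] unfolding F_def[abs_def] G_def[abs_def] m_def .
  have tFF: "tame (4 * (C * m v * (C * m v))) (\<lambda>y. F v y * F v y) (\<lambda>y. F v y *\<^sub>R G v y + F v y *\<^sub>R G v y)" for v
    by (rule tame_mult[OF tF tF])
  have m0: "0 \<le> m v" and m1: "m v \<le> 1" and mw: "m v * m v \<le> levy_weight v" for v
    by (auto simp: m_def truncation_square_le_levy_weight)
  have mw': "norm v * m v = levy_weight v" for v
    by (simp add: m_def levy_weight_def)
  have [measurable]: "m \<in> borel_measurable borel"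
    unfolding m_def[abs_def] by measurable
  have [measurable]: "(\<lambda>v. F v y) \<in> borel_measurable borel" "(\<lambda>v. G v y) \<in> borel_measurable borel" for y
    unfolding F_def G_def by measurable
  have KK: "integrable \<nu> (\<lambda>v. 4 * (C * m v * (C * m v)))"
  proof (rule integrable_of_weight_bound[where K = "4 * (C * C)"])
    fix v
    have "(C * C) * (m v * m v) \<le> (C * C) * levy_weight v"
      using mw by (intro mult_left_mono) auto
    then show "norm (4 * (C * m v * (C * m v))) \<le> 4 * (C * C) * levy_weight v"
      by (simp add: abs_mult mult_ac)
  qed measurable

  define H where "H y = (\<integral>v. F v y * F v y \<partial>\<nu>)" for y
  define H' where "H' y = (\<integral>v. F v y *\<^sub>R G v y + F v y *\<^sub>R G v y \<partial>\<nu>)" for y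
  have tH: "tame (\<integral>v. 4 * (C * m v * (C * m v)) \<partial>\<nu>) H H'"
    and iF: "\<And>y. integrable \<nu> (\<lambda>v. F v y * F v y)"
    and iG: "\<And>y. integrable \<nu> (\<lambda>v. F v y *\<^sub>R G v y + F v y *\<^sub>R G v y)"
    unfolding H_def[abs_def] H'_def[abs_def]
    by (rule tame_integral[OF KK tFF]; measurable)+
  have h: "h = (\<lambda>y. \<alpha> / 2 * H y)"
    by (simp add: h_def H_def F_def)
  have th: "tame (\<bar>\<alpha> / 2\<bar> * (\<integral>v. 4 * (C * m v * (C * m v)) \<partial>\<nu>)) h (\<lambda>y. (\<alpha> / 2) *\<^sub>R H' y)"
    unfolding h by (rule tame_cmult[OF tH])
  have gh: "gradient h = (\<lambda>y. (\<alpha> / 2) *\<^sub>R H' y)"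
    using tameD(1)[OF th] by (intro ext gradient_eq)

  have iS: "integrable \<nu> (\<lambda>v. S u v)" for u
    unfolding S_def using iF iG by (intro Bochner_Integration.integrable_diff integrable_inner_right) auto
  have S: "(\<integral>v. S u v \<partial>\<nu>) = H (x + u) - H x - u \<bullet> H' x" for u
    unfolding S_def H_def H'_def using iF iG by simp
  \<comment> \<open>The jump part of the generator applied to \<open>h\<close>: one factor \<alpha>
    comes from the compensated form, the factor \<open>\<alpha> / 2\<close> from
    \<open>h\<close>.\<close>
  have LH: "(\<integral>u. (gradient h (x + u) - gradient h x) \<bullet> u \<partial>\<nu>) = \<alpha>\<^sup>2 / 2 * (\<integral>u. (\<integral>v. S u v \<partial>\<nu>) \<partial>\<nu>)"
  proof -
    have "(\<integral>u. (gradient h (x + u) - gradient h x) \<bullet> u \<partial>\<nu>)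
        = \<alpha> * (\<integral>u. h (x + u) - h x - u \<bullet> gradient h x \<partial>\<nu>)"
      using integral_gradient_increment[OF th] unfolding gh .
    also have "(\<lambda>u. h (x + u) - h x - u \<bullet> gradient h x) = (\<lambda>u. \<alpha> / 2 * (\<integral>v. S u v \<partial>\<nu>))"
      unfolding gh unfolding h by (simp add: S algebra_simps)
    finally show ?thesis by (simp add: power2_eq_square)
  qed
  have iSS: "integrable \<nu> (\<lambda>u. \<integral>v. S u v \<partial>\<nu>)"
    unfolding S by (rule tame_remainder_integrable[OF tH])
  \<comment> \<open>The drift part of the generator applied to \<open>h\<close>; it cancels against
    the same integral in \<open>AfF\<close>.\<close>
  have BH: "x \<bullet> gradient h x = \<alpha> * (\<integral>v. F v x * (x \<bullet> G v x) \<partial>\<nu>)"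
  proof -
    have "x \<bullet> H' x = (\<integral>v. x \<bullet> (F v x *\<^sub>R G v x + F v x *\<^sub>R G v x) \<partial>\<nu>)"
      unfolding H'_def using iG by simp
    also have "\<dots> = (\<integral>v. 2 * (F v x * (x \<bullet> G v x)) \<partial>\<nu>)"
      by (simp add: inner_add_right)
    finally show ?thesis by (simp add: gh)
  qed

  have Fb: "\<bar>F v x\<bar> \<le> C * m v" for v
    using tameD(2)[OF tF] .
  have Rb: "\<bar>R u v\<bar> \<le> 2 * (C * m v) * levy_weight u" for u v
    unfolding R_def by (rule tame_remainder[OF tF])
  \<comment> \<open>Each factor contributes one \<open>m v\<close>, and the square of
    \<open>m v\<close> is below the weight of \<open>v\<close>. The product of weights justifies
    Fubini.\<close>
  have FR: "\<bar>F v x * R u v\<bar> \<le> 2 * (C * C) * (levy_weight u * levy_weight v)" for u v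
  proof -
    have "\<bar>F v x * R u v\<bar> \<le> (C * m v) * (2 * (C * m v) * levy_weight u)"
      unfolding abs_mult by (intro mult_mono' Fb Rb) auto
    also have "\<dots> = (2 * (C * C) * levy_weight u) * (m v * m v)"
      by simp
    also have "\<dots> \<le> (2 * (C * C) * levy_weight u) * levy_weight v"
      using C by (intro mult_left_mono mw) auto
    finally show ?thesis by (simp add: mult_ac)
  qed
  have [measurable]: "(\<lambda>(u, v). F v x * R u v) \<in> borel_measurable (borel \<Otimes>\<^sub>M borel)"
    unfolding F_def R_def G_def by measurable
  have iFR2: "integrable (\<nu> \<Otimes>\<^sub>M \<nu>) (\<lambda>(u, v). F v x * R u v)"
  proof (rule Bochner_Integration.integrable_bound)
    show "integrable (\<nu> \<Otimes>\<^sub>M \<nu>) (\<lambda>z. 2 * (C * C) * (case z of (u, v) \<Rightarrow> levy_weight u * levy_weight v))"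
      using integrable_weight_product by (rule integrable_mult_right)
    show "AE z in \<nu> \<Otimes>\<^sub>M \<nu>. norm (case z of (u, v) \<Rightarrow> F v x * R u v)
        \<le> norm (2 * (C * C) * (case z of (u, v) \<Rightarrow> levy_weight u * levy_weight v))"
    proof (rule AE_I2, clarify)
      fix u v
      show "norm (F v x * R u v) \<le> norm (2 * (C * C) * (levy_weight u * levy_weight v))"
        using FR[of v u] unfolding real_norm_def by linarith
    qed
  qed measurable
  have iFR: "integrable \<nu> (\<lambda>v. F v x * R u v)" for u
  proof (rule integrable_of_weight_bound[where K = "2 * (C * C) * levy_weight u"])
    show "(\<lambda>v. F v x * R u v) \<in> borel_measurable borel"
      unfolding F_def R_def G_def by measurable
    show "norm (F v x * R u v) \<le> 2 * (C * C) * levy_weight u * levy_weight v" for v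
      using FR[of v u] by (simp add: mult_ac)
  qed
  have iFR_u: "integrable \<nu> (\<lambda>u. \<integral>v. F v x * R u v \<partial>\<nu>)"
    by (rule P.integrable_fst[OF iFR2])
  have iFR_v: "integrable \<nu> (\<lambda>v. \<integral>u. F v x * R u v \<partial>\<nu>)"
    by (rule P.integrable_snd[OF iFR2])

  \<comment> \<open>The drift increment splits into \<open>x \<bullet> G v x\<close> and a radial
    term in \<open>v\<close>. In the jump part, the Taylor remainders of \<open>f\<close> at
    \<open>x + v\<close> and at \<open>x\<close> differ by \<open>R u v\<close>.\<close>
  have Af: "Af (x + v) - Af x = - (x \<bullet> G v x) - v \<bullet> f' (x + v) + \<alpha> * (\<integral>u. R u v \<partial>\<nu>)" for v
  proof -
    have "(\<integral>u. R u v \<partial>\<nu>)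
        = (\<integral>u. (f (x + v + u) - f (x + v) - u \<bullet> f' (x + v)) - (f (x + u) - f x - u \<bullet> f' x) \<partial>\<nu>)"
      by (simp add: R_def F_def G_def inner_diff_right algebra_simps)
    also have "\<dots> = (\<integral>u. f (x + v + u) - f (x + v) - u \<bullet> f' (x + v) \<partial>\<nu>) - (\<integral>u. f (x + u) - f x - u \<bullet> f' x \<partial>\<nu>)"
      by (intro Bochner_Integration.integral_diff tame_remainder_integrable[OF f])
    finally show ?thesis
      by (simp add: Af_def integral_gradient_increment[OF f] G_def inner_diff_right inner_add_left right_diff_distrib)
  qed
  have iFG: "integrable \<nu> (\<lambda>v. F v x * (x \<bullet> G v x))"
  proof -
    have "integrable \<nu> (\<lambda>v. 1 / 2 * (x \<bullet> (F v x *\<^sub>R G v x + F v x *\<^sub>R G v x)))"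
      using iG by (intro integrable_mult_right integrable_inner_right)
    then show ?thesis by (simp add: inner_add_right)
  qed
  have iFv: "integrable \<nu> (\<lambda>v. F v x * (v \<bullet> f' (x + v)))"
  proof (rule integrable_of_weight_bound[where K = "C * A"])
    fix v
    have "\<bar>v \<bullet> f' (x + v)\<bar> \<le> norm v * norm (f' (x + v))"
      by (rule Cauchy_Schwarz_ineq2)
    also have "\<dots> \<le> norm v * A"
      by (intro mult_left_mono tameD(3)[OF f]) simp
    finally have "\<bar>F v x * (v \<bullet> f' (x + v))\<bar> \<le> (C * m v) * (norm v * A)"
      unfolding abs_mult by (intro mult_mono' Fb) auto
    also have "\<dots> = C * A * (norm v * m v)" by simp
    finally show "norm (F v x * (v \<bullet> f' (x + v))) \<le> C * A * levy_weight v"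
      by (simp add: mw')
  qed measurable
  have radial: "(\<integral>v. F v x * (v \<bullet> f' (x + v)) \<partial>\<nu>) = \<alpha> / 2 * H x"
  proof -
    \<comment> \<open>The variable is now \<open>v\<close>, so the constants come from
      \<open>A\<close> and do not shrink with \<open>v\<close>; integrability is supplied by
      \<open>iF\<close> and \<open>iFv\<close>.\<close>
    have t: "tame (4 * (2 * A * (2 * A))) (\<lambda>v. F v x * F v x) (\<lambda>v. F v x *\<^sub>R f' (x + v) + F v x *\<^sub>R f' (x + v))"
      using tame_mult[OF tame_increment_from_point[OF f] tame_increment_from_point[OF f]]
      unfolding F_def .
    have eq: "v \<bullet> (F v x *\<^sub>R f' (x + v) + F v x *\<^sub>R f' (x + v)) = 2 * (F v x * (v \<bullet> f' (x + v)))" for v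
      by (simp add: inner_add_right)
    have "(\<integral>v. v \<bullet> (F v x *\<^sub>R f' (x + v) + F v x *\<^sub>R f' (x + v)) \<partial>\<nu>) = \<alpha> * H x"
      unfolding H_def
      by (rule integral_radial_derivative[OF iF _ tame_remainder[OF t]])
         (unfold eq, intro integrable_mult_right iFv)
    then show ?thesis unfolding eq by simp
  qed
  have AfF: "(\<integral>v. (Af (x + v) - Af x) * (f (x + v) - f x) \<partial>\<nu>)
      = - (\<integral>v. F v x * (x \<bullet> G v x) \<partial>\<nu>) - \<alpha> / 2 * H x + \<alpha> * (\<integral>u. (\<integral>v. F v x * R u v \<partial>\<nu>) \<partial>\<nu>)"
  proof -
    have "(\<integral>v. (Af (x + v) - Af x) * (f (x + v) - f x) \<partial>\<nu>)
       = (\<integral>v. - (F v x * (x \<bullet> G v x)) - F v x * (v \<bullet> f' (x + v)) + \<alpha> * (\<integral>u. F v x * R u v \<partial>\<nu>) \<partial>\<nu>)"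
      unfolding Af F_def [symmetric] by (simp add: algebra_simps)
    also have "\<dots> = - (\<integral>v. F v x * (x \<bullet> G v x) \<partial>\<nu>) - (\<integral>v. F v x * (v \<bullet> f' (x + v)) \<partial>\<nu>)
        + \<alpha> * (\<integral>v. (\<integral>u. F v x * R u v \<partial>\<nu>) \<partial>\<nu>)"
      using iFG iFv iFR_v by (simp del: integral_mult_right_zero)
    also have "(\<integral>v. (\<integral>u. F v x * R u v \<partial>\<nu>) \<partial>\<nu>) = (\<integral>u. (\<integral>v. F v x * R u v \<partial>\<nu>) \<partial>\<nu>)"
      by (rule P.Fubini_integral[OF iFR2])
    finally show ?thesis unfolding radial .
  qed
  have "0 \<le> (\<integral>u. (\<integral>v. (F v (x + u) - F v x) * (F v (x + u) - F v x) \<partial>\<nu>) \<partial>\<nu>)"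
    by (intro integral_nonneg_AE AE_I2) simp
  \<comment> \<open>Completing the square: since the gradient of the square of \<open>F v\<close> is
    twice \<open>F v\<close> times \<open>G v\<close>, the squared increment equals
    \<open>S u v - 2 * (F v x * R u v)\<close>.\<close>
  also have "\<dots> = (\<integral>u. (\<integral>v. S u v - 2 * (F v x * R u v) \<partial>\<nu>) \<partial>\<nu>)"
    by (simp add: S_def R_def inner_add_right algebra_simps)
  also have "\<dots> = (\<integral>u. (\<integral>v. S u v \<partial>\<nu>) \<partial>\<nu>) - 2 * (\<integral>u. (\<integral>v. F v x * R u v \<partial>\<nu>) \<partial>\<nu>)"
    using iS iFR iSS iFR_u by (simp del: integral_mult_right_zero)
  finally have "0 \<le> \<alpha>\<^sup>2 / 2 * ((\<integral>u. (\<integral>v. S u v \<partial>\<nu>) \<partial>\<nu>) - 2 * (\<integral>u. (\<integral>v. F v x * R u v \<partial>\<nu>) \<partial>\<nu>))"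
    by simp
  \<comment> \<open>The drift terms cancel, the radial term supplies
    \<open>\<alpha>\<^sup>2 / 2 * H x = \<alpha> * h x\<close>, and the nonnegative expression
    accounts for the rest.\<close>
  then show ?thesis
    unfolding LH BH AfF by (simp add: h power2_eq_square algebra_simps)
qed

end

section \<open>The curvature-dimension inequality\<close>

lemma homogeneous_stable_levy_measure:
  assumes "1 < \<alpha>" "\<alpha> < 2"
  shows "homogeneous_levy_measure \<alpha> (stable_levy_measure \<alpha> :: 'a::euclidean_space measure)"
  by standard
     (use assms in \<open>auto simp: emeasure_stable_levy_measure_0 integrable_levy_weight distr_stable_levy_measure_scaleR\<close>)

lemma carre_du_champs_eq:
  fixes f g :: "'a::euclidean_space \<Rightarrow> real"
  assumes \<alpha>: "0 \<le> \<alpha>"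
    and "(\<lambda>u. (f (x + u) - f x) * (g (x + u) - g x)) \<in> borel_measurable borel"
  shows "carre_du_champs \<alpha> f g x =
    \<alpha> / 2 * (\<integral>u. (f (x + u) - f x) * (g (x + u) - g x) \<partial>stable_levy_measure \<alpha>)"
  unfolding carre_du_champs_def scale_measure_eq_density
  using assms by (subst integral_density) auto

theorem proposition5p2:
  fixes \<alpha> :: real
    and M :: "'w measure"
    and X :: "'w \<Rightarrow> real ^ 'd"
  assumes "1 < \<alpha>" and "\<alpha> < 2"
    and "prob_space M"
    and "X \<in> borel_measurable M"
    and "rotationally_invariant (distr M borel X)"
    and "stable_law \<alpha> (distr M borel X)"
    and "has_levy_measure (distr M borel X) (stable_levy_measure \<alpha>)"
  shows "\<forall>f \<in> (Cc_infinity :: (real ^ 'd \<Rightarrow> real) set).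
           \<forall>x. carre_du_champs2 \<alpha> f f x \<ge> \<alpha> / 2 * carre_du_champs \<alpha> f f x"
proof (intro ballI allI)
  fix f :: "real ^ 'd \<Rightarrow> real" and x
  assume fC: "f \<in> Cc_infinity"
  interpret homogeneous_levy_measure \<alpha> "stable_levy_measure \<alpha> :: (real ^ 'd) measure"
    by (rule homogeneous_stable_levy_measure) fact+
  obtain A where f: "tame A f (gradient f)"
    using Cc_infinity_tame[OF fC] by blast
  obtain C where C: "0 \<le> C" and incr:
    "\<And>v. tame (C * min 1 (norm v)) (\<lambda>y. f (y + v) - f y) (\<lambda>y. gradient f (y + v) - gradient f y)"
    using Cc_infinity_increment_tame[OF fC] by blast
  have [measurable]: "f \<in> borel_measurable borel" "gradient f \<in> borel_measurable borel"
    using f by (auto intro: tame_borel_measurable)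
  \<comment> \<open>Required for pulling the factor \<alpha> out of \<Gamma>(Af, f) by
    \<open>carre_du_champs_eq\<close>.\<close>
  have [measurable]: "stable_generator \<alpha> f \<in> borel_measurable borel"
    unfolding stable_generator_def [abs_def] by measurable
  have h: "carre_du_champs \<alpha> f f y =
      \<alpha> / 2 * (\<integral>v. (f (y + v) - f y) * (f (y + v) - f y) \<partial>stable_levy_measure \<alpha>)" for y
    using \<open>1 < \<alpha>\<close> by (intro carre_du_champs_eq) auto
  have "carre_du_champs \<alpha> (stable_generator \<alpha> f) f x = \<alpha> / 2 *
      (\<integral>v. (stable_generator \<alpha> f (x + v) - stable_generator \<alpha> f x) * (f (x + v) - f x) \<partial>stable_levy_measure \<alpha>)"
    using \<open>1 < \<alpha>\<close> by (intro carre_du_champs_eq) auto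
  \<comment> \<open>With equal arguments the two cross terms in \<open>carre_du_champs2\<close>
    coincide and add up to \<alpha> times this integral; halving the inequality gives the
    claim.\<close>
  moreover have "\<alpha> * carre_du_champs \<alpha> f f x \<le> stable_generator \<alpha> (carre_du_champs \<alpha> f f) x -
      \<alpha> * (\<integral>v. (stable_generator \<alpha> f (x + v) - stable_generator \<alpha> f x) * (f (x + v) - f x) \<partial>stable_levy_measure \<alpha>)"
    using curvature_dimension_inequality[OF f incr C, of x]
    unfolding h [symmetric] stable_generator_def [symmetric] .
  ultimately show "\<alpha> / 2 * carre_du_champs \<alpha> f f x \<le> carre_du_champs2 \<alpha> f f x"
    by (simp add: carre_du_champs2_def)
qed

end
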